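(* Every threshold complex is an initial segment complex: if $\Delta\subseteq2^{[n]}$ is a threshold complex, then there exist a qualitative probability order $\preceq$ on $[n]$ and $T\subseteq[n]$ such that $\Delta=\Delta(\preceq,T)=\{X\subseteq[n]\mid X\prec T\}$.
   Context: $[n]=\{1,\dots,n\}$ and $2^{[n]}$ is the set of all subsets of $[n]$. An order is a reflexive, complete and transitive binary relation. A qualitative probability order on $[n]$ is an order $\preceq$ on $2^{[n]}$ such that (1) $\emptyset\preceq A$ for every nonempty $A\subseteq[n]$, and (2) for all $A,B,C\subseteq[n]$ with $(A\cup B)\cap C=\emptyset$: $A\preceq B\iff A\cup C\preceq B\cup C$. $X\prec Y$ means $X\preceq Y$ but not $Y\preceq X$. A family $\Delta\subseteq2^{[n]}$ closed under taking subsets is a simplicial complex; it is a threshold complex if there exist non-negative reals $w_1,\dots,w_n$ and a positive constant $q$ such that for all $A\subseteq[n]$: $A\in\Delta\iff\sum_{i\in A}w_i<q$. Simplicial complexes of the form $\Delta(\preceq,T)$ are called initial segment complexes.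
   Formalization: The full simplex Δ = 2^[n] is excluded: it is a threshold complex (all weights 0, q = 1), but T ≺ T never holds, so {X ⊆ [n] | X ≺ T} never contains T and cannot equal 2^[n]. *)

theory Defs
  imports Complex_Main
begin

definition qualitative_probability_order :: "nat \<Rightarrow> nat set rel \<Rightarrow> bool" where
  "qualitative_probability_order n r \<longleftrightarrow>
     preorder_on (Pow {1..n}) r \<and> total_on (Pow {1..n}) r \<and>
     (\<forall>A \<subseteq> {1..n}. A \<noteq> {} \<longrightarrow> ({}, A) \<in> r) \<and>
     (\<forall>A \<subseteq> {1..n}. \<forall>B \<subseteq> {1..n}. \<forall>C \<subseteq> {1..n}. (A \<union> B) \<inter> C = {} \<longrightarrow>
        ((A, B) \<in> r \<longleftrightarrow> (A \<union> C, B \<union> C) \<in> r))"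

definition strict_part :: "'a rel \<Rightarrow> 'a \<Rightarrow> 'a \<Rightarrow> bool" where
  "strict_part r x y \<longleftrightarrow> (x, y) \<in> r \<and> (y, x) \<notin> r"

(* The void complex and complexes in which some {i} is missing are allowed. *)
definition simplicial_complex :: "nat \<Rightarrow> nat set set \<Rightarrow> bool" where
  "simplicial_complex n \<Delta> \<longleftrightarrow>
     \<Delta> \<subseteq> Pow {1..n} \<and> (\<forall>B \<in> \<Delta>. \<forall>A \<subseteq> B. A \<in> \<Delta>)"

definition threshold_complex :: "nat \<Rightarrow> nat set set \<Rightarrow> bool" where
  "threshold_complex n \<Delta> \<longleftrightarrow>
     simplicial_complex n \<Delta> \<and>
     (\<exists>(w :: nat \<Rightarrow> real) (q :: real). (\<forall>i \<in> {1..n}. 0 \<le> w i) \<and> 0 < q \<and>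
        (\<forall>A \<subseteq> {1..n}. A \<in> \<Delta> \<longleftrightarrow> (\<Sum>i\<in>A. w i) < q))"

definition initial_segment :: "nat \<Rightarrow> nat set rel \<Rightarrow> nat set \<Rightarrow> nat set set" where
  "initial_segment n r T = {X. X \<subseteq> {1..n} \<and> strict_part r X T}"

definition initial_segment_complex :: "nat \<Rightarrow> nat set set \<Rightarrow> bool" where
  "initial_segment_complex n \<Delta> \<longleftrightarrow>
     simplicial_complex n \<Delta> \<and>
     (\<exists>r T. qualitative_probability_order n r \<and> T \<subseteq> {1..n} \<and> \<Delta> = initial_segment n r T)"

(* The full simplex has to be treated separately: it is a threshold complex (take q larger
   than the total weight), but T itself is never strictly below T, so no initial segment
   with T a subset of {1..n} is the whole power set. *)
lemma threshold_complex_Pow: "threshold_complex n (Pow {1..n})"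
  unfolding threshold_complex_def simplicial_complex_def
  by (auto intro!: exI[of _ "\<lambda>_. 0"] exI[of _ 1])

lemma not_initial_segment_complex_Pow: "\<not> initial_segment_complex n (Pow {1..n})"
  by (auto simp: initial_segment_complex_def initial_segment_def strict_part_def)

end

theory Submission
  imports Defs
begin

text \<open>Order the subsets of \<open>{1..n}\<close> by their total weight and let \<open>T\<close> be a non-face
  of minimal weight. Faces weigh less than \<open>q\<close>, hence less than \<open>T\<close>, and non-faces weigh
  at least as much as \<open>T\<close>.\<close>

text \<open>The bounds on \<open>A\<close> and \<open>B\<close> keep the relation inside
  \<open>Pow {1..n}\<close>, as \<open>preorder_on\<close> demands. Distinct sets of equal weight
  are tied.\<close>

definition weight_order :: "nat \<Rightarrow> (nat \<Rightarrow> real) \<Rightarrow> nat set rel" where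
  "weight_order n w = {(A, B). A \<subseteq> {1..n} \<and> B \<subseteq> {1..n} \<and> sum w A \<le> sum w B}"

text \<open>Weights are additive: joining a disjoint \<open>C\<close> raises both sides by
  \<open>sum w C\<close>, which cancels. Nonnegativity puts the empty set at the bottom.\<close>

lemma qualitative_probability_order_weight_order:
  assumes w: "\<forall>i \<in> {1..n}. 0 \<le> w i"
  shows "qualitative_probability_order n (weight_order n w)"
proof -
  have "preorder_on (Pow {1..n}) (weight_order n w)"
    unfolding preorder_on_def
    by (intro conjI subsetI refl_onI transI) (auto simp: weight_order_def)
  moreover have "total_on (Pow {1..n}) (weight_order n w)"
    by (auto simp: total_on_def weight_order_def)
  moreover have "({}, A) \<in> weight_order n w" if "A \<subseteq> {1..n}" for A
    using that w by (auto simp: weight_order_def intro!: sum_nonneg)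
  moreover have "(A, B) \<in> weight_order n w \<longleftrightarrow> (A \<union> C, B \<union> C) \<in> weight_order n w"
    if sub: "A \<subseteq> {1..n}" "B \<subseteq> {1..n}" "C \<subseteq> {1..n}" and disj: "(A \<union> B) \<inter> C = {}" for A B C
  proof -
    have "finite A" "finite B" "finite C"
      using sub finite_subset by blast+
    then have "sum w (A \<union> C) = sum w A + sum w C" "sum w (B \<union> C) = sum w B + sum w C"
      using disj by (auto intro!: sum.union_disjoint)
    then show ?thesis
      using sub by (simp add: weight_order_def)
  qed
  ultimately show ?thesis
    unfolding qualitative_probability_order_def by simp
qed

theorem lemma3:
  fixes n :: nat and \<Delta> :: "nat set set"
  assumes "threshold_complex n \<Delta>"
    and "\<Delta> \<noteq> Pow {1..n}"
  shows "initial_segment_complex n \<Delta>"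
proof -
  obtain w :: "nat \<Rightarrow> real" and q where complex: "simplicial_complex n \<Delta>"
    and w: "\<forall>i \<in> {1..n}. 0 \<le> w i"
    and faces: "\<And>A. A \<subseteq> {1..n} \<Longrightarrow> A \<in> \<Delta> \<longleftrightarrow> sum w A < q"
    using assms(1) unfolding threshold_complex_def by auto
  have sub: "\<Delta> \<subseteq> Pow {1..n}"
    using complex by (simp add: simplicial_complex_def)
  define N where "N = Pow {1..n} - \<Delta>"
  \<comment> \<open>Excluding the full simplex provides a non-face; finiteness ensures that the
    minimum defining \<open>T\<close> is attained.\<close>
  have N: "finite N" "N \<noteq> {}"
    using sub assms(2) by (auto simp: N_def)
  define T where "T = arg_min_on (sum w) N"
  have "T \<in> N"
    unfolding T_def by (rule arg_min_if_finite(1)[OF N])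
  then have T: "T \<subseteq> {1..n}" "T \<notin> \<Delta>"
    by (auto simp: N_def)
  have T_min: "sum w T \<le> sum w X" if "X \<subseteq> {1..n}" "X \<notin> \<Delta>" for X
    unfolding T_def by (rule arg_min_least[OF N]) (use that in \<open>simp add: N_def\<close>)
  \<comment> \<open>The threshold \<open>q\<close> need not be the weight of any set. It can be
    traded for \<open>sum w T\<close> because \<open>q \<le> sum w T\<close> and no subset has a
    weight from \<open>q\<close> up to, but excluding, \<open>sum w T\<close>.\<close>
  have "X \<in> \<Delta> \<longleftrightarrow> sum w X < sum w T" if "X \<subseteq> {1..n}" for X
    using that faces[of X] faces[of T] T T_min[of X] by fastforce
  \<comment> \<open>Real weights are linearly ordered, so on subsets of \<open>{1..n}\<close> the
    strict part of the order is strict comparison of weights.\<close>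
  then have "\<Delta> = initial_segment n (weight_order n w) T"
    using sub T by (auto simp: initial_segment_def strict_part_def weight_order_def)
  then show ?thesis
    using complex qualitative_probability_order_weight_order[OF w] T
    unfolding initial_segment_complex_def by blast
qed

end
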